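(* Let $\Sigma$ be the linear discrete-time system $x(t+1)=Ax(t)+Bu(t)$, $y(t)=Cx(t)+Du(t)$ with $x(t)\in\mathbb{R}^n$, $u(t),y(t)\in\mathbb{R}^p$, and let $\Psi$ be a stochastic memoryless map with input $y(t)\in\mathbb{R}^p$ and output $z(t)\in\mathbb{R}^p$. Connect them in negative feedback: $z(t)=\Psi(y(t))$ and $u(t)=-z(t)$. Let $\gamma\in\mathbb{R}$. Suppose that $\Sigma$ is $(\Theta_p,\gamma I_p,0.5I_p)$ dissipative with storage function $V:\mathbb{R}^n\to\mathbb{R}_+$, and that for some scalar $\delta\ge\gamma$ the map $\Psi$ satisfies $$E[z^T(t)y(t)]\ \ge\ \delta\,E[z^T(t)z(t)]$$ for all time steps $t$ (for every value of the input $y(t)\in\mathbb{R}^p$, the expectation being taken over the random output $z(t)$ of $\Psi$ for the given $y(t)$). Then for every $t$ $$E\big[V(x(t+1))\,\big|\,x(t)\big]-V(x(t))\le 0 .$$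
   Context: $\Theta_p$ is the $p\times p$ zero matrix and $I_p$ the $p\times p$ identity. Dissipativity: for $Q=Q^T$, $R=R^T$ and $S$ of size $p\times p$, the system $\Sigma$ is $(Q,R,S)$ dissipative with storage function $V$ if $V:\mathbb{R}^n\to\mathbb{R}_+$ is positive semidefinite and $V(x(t+1))-V(x(t))\le y^T(t)Qy(t)+u^T(t)Ru(t)+2y^T(t)Su(t)$ for all $x(t)\in\mathbb{R}^n$ and $u(t)\in\mathbb{R}^p$. Hence $(\Theta_p,\gamma I_p,0.5I_p)$ dissipative means $V(Ax+Bu)-V(x)\le y^Tu+\gamma u^Tu$ with $y=Cx+Du$, for all $x,u$. Stochastic memoryless map: there are a finite set $\{\beta^1,\dots,\beta^K\}\subset\mathbb{R}^p$ and functions $P^k:\mathbb{R}^p\to[0,1]$ with $\sum_{k=1}^K P^k(\alpha)=1$ for all $\alpha$, such that for input $\alpha$ the output equals $\beta^k$ with probability $P^k(\alpha)$. For a function $W(\alpha,\beta)$ of the input and output, its expectation for given input $\alpha$ is $E[W(\alpha,\Psi(\alpha))]=\sum_{k=1}^K W(\alpha,\beta^k)P^k(\alpha)$. In the feedback loop, conditionally on the current state $x(t)$ and on $y(t)$, the output $z(t)$ equals $\beta^k$ with probability $P^k(y(t))$. *)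

theory Defs
  imports "HOL-Probability.Probability"
begin

definition pos_semidef_fun :: "('a::zero \<Rightarrow> real) \<Rightarrow> bool" where
  "pos_semidef_fun V \<longleftrightarrow> V 0 = 0 \<and> (\<forall>x. 0 \<le> V x)"

text \<open>The parameters \<open>A\<close>, \<open>B\<close>, \<open>C\<close>, \<open>D\<close> stand for the system
  \<open>x(t+1) = A x(t) + B u(t)\<close>, \<open>y(t) = C x(t) + D u(t)\<close>.\<close>

definition dissipative ::
  "real^'n^'n \<Rightarrow> real^'p^'n \<Rightarrow> real^'n^'p \<Rightarrow> real^'p^'p \<Rightarrow>
   real^'p^'p \<Rightarrow> real^'p^'p \<Rightarrow> real^'p^'p \<Rightarrow> (real^'n \<Rightarrow> real) \<Rightarrow> bool" where
  "dissipative A B C D Q R S V \<longleftrightarrow>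
     transpose Q = Q \<and> transpose R = R \<and> pos_semidef_fun V \<and>
     (\<forall>x u. let y = C *v x + D *v u in
        V (A *v x + B *v u) - V x \<le> y \<bullet> (Q *v y) + u \<bullet> (R *v u) + 2 * (y \<bullet> (S *v u)))"

definition stochastic_map :: "nat \<Rightarrow> (nat \<Rightarrow> real^'p) \<Rightarrow> (nat \<Rightarrow> real^'p \<Rightarrow> real) \<Rightarrow> bool" where
  "stochastic_map K \<beta> P \<longleftrightarrow>
     inj_on \<beta> {1..K} \<and>
     (\<forall>k\<in>{1..K}. \<forall>\<alpha>. 0 \<le> P k \<alpha> \<and> P k \<alpha> \<le> 1) \<and>
     (\<forall>\<alpha>. (\<Sum>k=1..K. P k \<alpha>) = 1)"

definition map_expectation ::
  "nat \<Rightarrow> (nat \<Rightarrow> real^'p) \<Rightarrow> (nat \<Rightarrow> real^'p \<Rightarrow> real) \<Rightarrow>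
   (real^'p \<Rightarrow> real^'p \<Rightarrow> real) \<Rightarrow> real^'p \<Rightarrow> real" where
  "map_expectation K \<beta> P W \<alpha> = (\<Sum>k=1..K. W \<alpha> (\<beta> k) * P k \<alpha>)"

abbreviation generated_by :: "'w measure \<Rightarrow> ('w \<Rightarrow> 'b::topological_space) \<Rightarrow> 'w measure" where
  "generated_by M f \<equiv> vimage_algebra (space M) f borel"

text \<open>If \<open>D \<noteq> 0\<close> the loop is algebraic: \<open>y(t)\<close> depends on \<open>z(t)\<close>, whose law in turn is
  prescribed by \<open>y(t)\<close>. A closed-loop trajectory is therefore any process that satisfies the
  interconnection equations and has the prescribed law of \<open>z(t)\<close> conditionally on
  \<open>(x(t), y(t))\<close>; the joint law of \<open>x(t)\<close> and \<open>y(t)\<close> is otherwise unrestricted.\<close>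

definition feedback_loop ::
  "'w measure \<Rightarrow> real^'n^'n \<Rightarrow> real^'p^'n \<Rightarrow> real^'n^'p \<Rightarrow> real^'p^'p \<Rightarrow>
   nat \<Rightarrow> (nat \<Rightarrow> real^'p) \<Rightarrow> (nat \<Rightarrow> real^'p \<Rightarrow> real) \<Rightarrow>
   (nat \<Rightarrow> 'w \<Rightarrow> real^'n) \<Rightarrow> (nat \<Rightarrow> 'w \<Rightarrow> real^'p) \<Rightarrow>
   (nat \<Rightarrow> 'w \<Rightarrow> real^'p) \<Rightarrow> (nat \<Rightarrow> 'w \<Rightarrow> real^'p) \<Rightarrow> bool" where
  "feedback_loop M A B C D K \<beta> P x u y z \<longleftrightarrow>
     (\<forall>t. x t \<in> borel_measurable M \<and> y t \<in> borel_measurable M \<and> z t \<in> borel_measurable M \<and>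
        (\<forall>\<omega>\<in>space M.
           x (Suc t) \<omega> = A *v x t \<omega> + B *v u t \<omega> \<and>
           y t \<omega> = C *v x t \<omega> + D *v u t \<omega> \<and>
           u t \<omega> = - z t \<omega>) \<and>
        (\<forall>k\<in>{1..K}. AE \<omega> in M.
           real_cond_exp M (generated_by M (\<lambda>\<omega>. (x t \<omega>, y t \<omega>)))
             (indicator {\<omega>\<in>space M. z t \<omega> = \<beta> k}) \<omega> = P k (y t \<omega>)))"

end

theory Submission
  imports Defs
begin

text \<open>On the event \<open>z(t) = \<beta>\<^sup>k\<close> dissipativity bounds \<open>V(x(t+1))\<close> by
  \<open>V(x(t)) + \<gamma> \<bar>\<beta>\<^sup>k\<bar>\<^sup>2 - \<beta>\<^sup>k \<bullet> y(t)\<close>, a function of \<open>(x(t), y(t))\<close>. Averaging over \<open>k\<close> with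
  the conditional weights \<open>P\<^sup>k(y(t))\<close> gives
  \<open>V(x(t)) + \<gamma> E[z \<bullet> z] - E[z \<bullet> y] \<le> V(x(t))\<close>, because \<open>E[z \<bullet> y] \<ge> \<delta> E[z \<bullet> z] \<ge> \<gamma> E[z \<bullet> z]\<close>;
  conditioning further on \<open>x(t)\<close> preserves the bound. Since \<open>V(x(t))\<close> and \<open>y(t)\<close> need not be
  integrable, everything is done with nonnegative conditional expectations.\<close>

lemma subalgebra_generated_by:
  assumes "f \<in> borel_measurable M"
  shows "subalgebra M (generated_by M f)"
  unfolding subalgebra_def using sets_image_in_sets[OF refl assms] by simp

lemma measurable_generated_by [simp]: "f \<in> borel_measurable (generated_by M f)"
  by (rule measurable_vimage_algebra1) simp

lemma (in sigma_finite_subalgebra) nn_cond_exp_sum_finite: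
  assumes "finite I" "\<And>i. i \<in> I \<Longrightarrow> f i \<in> borel_measurable M"
  shows "AE x in M. nn_cond_exp M F (\<lambda>x. \<Sum>i\<in>I. f i x) x = (\<Sum>i\<in>I. nn_cond_exp M F (f i) x)"
  using assms
proof (induction I rule: finite_induct)
  case empty
  then show ?case using nn_cond_exp_F_meas[of "\<lambda>_. 0"] by simp
next
  case (insert i I)
  have "AE x in M. nn_cond_exp M F (f i) x + nn_cond_exp M F (\<lambda>x. \<Sum>j\<in>I. f j x) x
      = nn_cond_exp M F (\<lambda>x. f i x + (\<Sum>j\<in>I. f j x)) x"
    using insert.prems by (intro nn_cond_exp_sum borel_measurable_sum) auto
  moreover have "AE x in M. nn_cond_exp M F (\<lambda>x. \<Sum>j\<in>I. f j x) x = (\<Sum>j\<in>I. nn_cond_exp M F (f j) x)"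
    using insert by simp
  ultimately show ?case
    by eventually_elim (use insert.hyps in simp)
qed

text \<open>\<open>real_cond_exp\<close> is built from \<open>enn2real\<close>, which sends
  \<open>top\<close> to 0, so the point is finiteness; it comes from monotonicity against the
  constant 1. The negative part of an indicator contributes 0. This turns the real-valued
  conditional law of the loop into one usable with nonnegative conditional expectations.\<close>

lemma (in sigma_finite_subalgebra) nn_cond_exp_indicator:
  assumes [measurable]: "S \<in> sets M"
  shows "AE x in M. nn_cond_exp M F (indicator S) x = ennreal (real_cond_exp M F (indicator S) x)"
proof -
  have "AE x in M. nn_cond_exp M F (indicator S) x \<le> nn_cond_exp M F (\<lambda>_. 1) x"
    by (rule nn_cond_exp_mono) (auto simp: indicator_def)
  moreover have "AE x in M. 1 = nn_cond_exp M F (\<lambda>_. 1) x"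
    by (rule nn_cond_exp_F_meas) simp
  moreover have "AE x in M. 0 = nn_cond_exp M F (\<lambda>_. 0) x"
    by (rule nn_cond_exp_F_meas) simp
  ultimately show ?thesis
  proof eventually_elim
    case (elim x)
    have neg: "(\<lambda>x. ennreal (- indicator S x)) = (\<lambda>_. 0)"
      by (auto simp: indicator_def fun_eq_iff ennreal_neg)
    have pos: "(\<lambda>x. ennreal (indicator S x)) = indicator S"
      by (auto simp: indicator_def fun_eq_iff)
    have "nn_cond_exp M F (indicator S) x < top"
      using elim by (metis ennreal_one_less_top le_less_trans)
    then show ?case
      using elim(3)[symmetric] unfolding real_cond_exp_def neg pos by simp
  qed
qed

text \<open>Integrating a conditional probability over \<open>M\<close> returns the probability of
  the event, so the disjoint events have total mass equal to the integral of 1.\<close>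

lemma AE_covered_if_cond_prob_sum_eq_1:
  assumes "prob_space M" and sub: "subalgebra M G" and I: "finite I"
    and S: "\<And>k. k \<in> I \<Longrightarrow> S k \<in> sets M" and disj: "disjoint_family_on S I"
    and one: "AE w in M. (\<Sum>k\<in>I. nn_cond_exp M G (indicator (S k)) w) = 1"
  shows "AE w in M. w \<in> (\<Union>k\<in>I. S k)"
proof -
  interpret prob_space M by fact
  interpret finite_measure_subalgebra M G by unfold_locales (rule sub)
  have "emeasure M (\<Union>k\<in>I. S k) = (\<Sum>k\<in>I. emeasure M (S k))"
    by (rule sum_emeasure[symmetric]) (use S disj I in auto)
  also have "\<dots> = (\<Sum>k\<in>I. \<integral>\<^sup>+ w. nn_cond_exp M G (indicator (S k)) w \<partial>M)"
  proof (rule sum.cong[OF refl])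
    fix k assume "k \<in> I"
    then show "emeasure M (S k) = (\<integral>\<^sup>+ w. nn_cond_exp M G (indicator (S k)) w \<partial>M)"
      using nn_cond_exp_intg[of "\<lambda>_. 1" "indicator (S k)"] S by simp
  qed
  also have "\<dots> = (\<integral>\<^sup>+ w. (\<Sum>k\<in>I. nn_cond_exp M G (indicator (S k)) w) \<partial>M)"
    by (rule nn_integral_sum[symmetric]) simp
  also have "\<dots> = (\<integral>\<^sup>+ w. 1 \<partial>M)"
    using one by (rule nn_integral_cong_AE)
  also have "\<dots> = 1" by (simp add: emeasure_space_1)
  finally have "emeasure M (\<Union>k\<in>I. S k) = 1" .
  then have "prob (\<Union>k\<in>I. S k) = 1"
    by (simp add: measure_def)
  then show ?thesis
    by (rule AE_prob_1)
qed

theorem proposition4: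
  fixes A :: "real^'n^'n" and B :: "real^'p^'n" and C :: "real^'n^'p" and D :: "real^'p^'p"
    and V :: "real^'n \<Rightarrow> real" and \<gamma> \<delta> :: real
    and K :: nat and \<beta> :: "nat \<Rightarrow> real^'p" and P :: "nat \<Rightarrow> real^'p \<Rightarrow> real"
    and M :: "'w measure"
    and x :: "nat \<Rightarrow> 'w \<Rightarrow> real^'n" and u y z :: "nat \<Rightarrow> 'w \<Rightarrow> real^'p"
  assumes "dissipative A B C D 0 (\<gamma> *\<^sub>R mat 1) ((1/2) *\<^sub>R mat 1) V"
    and "stochastic_map K \<beta> P"
    and "\<delta> \<ge> \<gamma>"
    and "\<And>\<alpha>. map_expectation K \<beta> P (\<lambda>a b. b \<bullet> a) \<alpha> \<ge> \<delta> * map_expectation K \<beta> P (\<lambda>a b. b \<bullet> b) \<alpha>"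
    and "prob_space M"
    and "feedback_loop M A B C D K \<beta> P x u y z"
    and "\<And>t. (\<lambda>\<omega>. V (x t \<omega>)) \<in> borel_measurable (generated_by M (x t))"
  shows "\<forall>t. AE \<omega> in M.
    enn2ereal (nn_cond_exp M (generated_by M (x t)) (\<lambda>\<omega>. ennreal (V (x (Suc t) \<omega>))) \<omega>)
      - ereal (V (x t \<omega>)) \<le> 0"
proof
  fix t
  interpret prob_space M by fact
  \<comment> \<open>Conditioning takes two stages: the law of z(t) is prescribed given (x(t), y(t)),
    that is on \<open>G\<close>, whereas the claim conditions on x(t) alone, that is on
    \<open>F\<close>.\<close>
  define F where "F = generated_by M (x t)"
  define G where "G = generated_by M (\<lambda>w. (x t w, y t w))"
  define S where "S k = {w \<in> space M. z t w = \<beta> k}" for k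
  define h where "h k w = V (x t w) + \<gamma> * (\<beta> k \<bullet> \<beta> k) - \<beta> k \<bullet> y t w" for k w
  note loop = assms(6)[unfolded feedback_loop_def]
  have [measurable]: "x s \<in> borel_measurable M" "y s \<in> borel_measurable M"
      "z s \<in> borel_measurable M" for s
    using loop by auto
  have V0: "0 \<le> V a" for a
    using assms(1) by (auto simp: dissipative_def pos_semidef_fun_def)
  have diss: "V (A *v a + B *v v) - V a \<le> (C *v a + D *v v) \<bullet> v + \<gamma> * (v \<bullet> v)" for a v
  proof -
    have gain: "v \<bullet> ((\<gamma> *\<^sub>R mat 1) *v v) = \<gamma> * (v \<bullet> v)"
      and out: "b \<bullet> (((1/2) *\<^sub>R mat 1) *v v) = (b \<bullet> v) / 2" for b :: "real^'p"
      by (simp_all flip: scaleR_matrix_vector_assoc)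
    have "V (A *v a + B *v v) - V a
        \<le> v \<bullet> ((\<gamma> *\<^sub>R mat 1) *v v) + 2 * ((C *v a + D *v v) \<bullet> (((1/2) *\<^sub>R mat 1) *v v))"
      using assms(1) unfolding dissipative_def Let_def by simp
    then show ?thesis unfolding gain out by simp
  qed
  have subF: "subalgebra M F" and subG: "subalgebra M G"
    unfolding F_def G_def by (rule subalgebra_generated_by, measurable)+
  have xyG: "(\<lambda>w. (x t w, y t w)) \<in> borel_measurable G"
    unfolding G_def by simp
  have xG: "x t \<in> borel_measurable G"
    using measurable_compose[OF xyG, of fst borel] by (simp add: borel_measurable_continuous_onI continuous_on_fst)
  have yG [measurable]: "y t \<in> borel_measurable G"
    using measurable_compose[OF xyG, of snd borel] by (simp add: borel_measurable_continuous_onI continuous_on_snd)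
  have FG: "subalgebra G F"
    using subalgebra_generated_by[OF xG] by (simp add: F_def G_def)
  \<comment> \<open>\<open>V\<close> itself is not assumed Borel. Measurability of V(x(t)) over
    \<open>F\<close> is a hypothesis, and it passes up to the finer \<open>G\<close> and
    \<open>M\<close>.\<close>
  have VF: "(\<lambda>w. V (x t w)) \<in> borel_measurable F"
    unfolding F_def by (rule assms(7))
  have VG [measurable]: "(\<lambda>w. V (x t w)) \<in> borel_measurable G"
    by (rule measurable_from_subalg[OF FG VF])
  have VM [measurable]: "(\<lambda>w. V (x s w)) \<in> borel_measurable M" for s
    by (rule measurable_from_subalg[OF subalgebra_generated_by assms(7)]) simp
  have hG [measurable]: "h k \<in> borel_measurable G" for k
    unfolding h_def by measurable
  have hM [measurable]: "h k \<in> borel_measurable M" for k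
    by (rule measurable_from_subalg[OF subG hG])
  have S [measurable]: "S k \<in> sets M" for k
    unfolding S_def by measurable
  interpret F: finite_measure_subalgebra M F by unfold_locales (rule subF)
  interpret G: finite_measure_subalgebra M G by unfold_locales (rule subG)

  have P: "0 \<le> P k a" if "k \<in> {1..K}" for k a
    using assms(2) that by (auto simp: stochastic_map_def)
  have P1: "(\<Sum>k=1..K. P k a) = 1" for a
    using assms(2) by (auto simp: stochastic_map_def)
  have condP: "AE w in M. \<forall>k\<in>{1..K}. nn_cond_exp M G (indicator (S k)) w = ennreal (P k (y t w))"
  proof (rule AE_finite_allI)
    fix k assume k: "k \<in> {1..K}"
    have "AE w in M. real_cond_exp M G (indicator (S k)) w = P k (y t w)"
      using loop k unfolding G_def S_def by blast
    with G.nn_cond_exp_indicator[OF S[of k]]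
    show "AE w in M. nn_cond_exp M G (indicator (S k)) w = ennreal (P k (y t w))"
      by eventually_elim simp
  qed simp
  \<comment> \<open>The loop prescribes only conditional probabilities. That z(t) almost surely
    takes one of the values \<open>\<beta> k\<close> follows because these weights sum to 1 and,
    \<open>\<beta>\<close> being injective, the events \<open>S k\<close> are disjoint.\<close>
  have covered: "AE w in M. w \<in> (\<Union>k\<in>{1..K}. S k)"
  proof (rule AE_covered_if_cond_prob_sum_eq_1[OF assms(5) subG])
    show "disjoint_family_on S {1..K}"
      using assms(2) unfolding stochastic_map_def disjoint_family_on_def S_def inj_on_def by fastforce
    show "AE w in M. (\<Sum>k\<in>{1..K}. nn_cond_exp M G (indicator (S k)) w) = 1"
      using condP
    proof eventually_elim
      case (elim w)
      then have "(\<Sum>k\<in>{1..K}. nn_cond_exp M G (indicator (S k)) w) = (\<Sum>k\<in>{1..K}. ennreal (P k (y t w)))"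
        by (intro sum.cong) auto
      also have "\<dots> = ennreal (\<Sum>k\<in>{1..K}. P k (y t w))"
        by (rule sum_ennreal) (rule P)
      finally show ?case by (simp only: P1 ennreal_1)
    qed
  qed simp_all
  have step: "V (x (Suc t) w) \<le> h k w" if "w \<in> S k" for k w
  proof -
    have w: "w \<in> space M" "z t w = \<beta> k" using that by (auto simp: S_def)
    then have eqs: "x (Suc t) w = A *v x t w + B *v u t w" "y t w = C *v x t w + D *v u t w"
        "u t w = - \<beta> k"
      using loop by auto
    have "V (x (Suc t) w) - V (x t w) \<le> y t w \<bullet> u t w + \<gamma> * (u t w \<bullet> u t w)"
      using diss[of "x t w" "u t w"] by (simp only: eqs(1,2))
    then show ?thesis
      by (simp add: eqs(3) h_def inner_commute)
  qed

  \<comment> \<open>\<open>h k\<close> can be negative, but only where \<open>\<beta> k\<close> has conditional probability 0, since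
    \<open>0 \<le> V (x (Suc t))\<close>.\<close>
  have null: "AE w in M. \<forall>k\<in>{1..K}. h k w < 0 \<longrightarrow> P k (y t w) = 0"
  proof (rule AE_finite_allI)
    fix k assume k: "k \<in> {1..K}"
    \<comment> \<open>The event \<open>h k w < 0\<close> lies in \<open>G\<close>, so its indicator
      can be moved inside the conditional expectation, where it meets \<open>S k\<close> in the
      empty set.\<close>
    have "AE w in M. indicator {w \<in> space G. h k w < 0} w * nn_cond_exp M G (indicator (S k)) w
        = nn_cond_exp M G (\<lambda>w. indicator {w \<in> space G. h k w < 0} w * indicator (S k) w) w"
      by (rule G.nn_cond_exp_prod) auto
    moreover have "(\<lambda>w. indicator {w \<in> space G. h k w < 0} w * indicator (S k) w) = (\<lambda>_. 0::ennreal)"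
    proof
      fix w
      have "w \<notin> {w \<in> space G. h k w < 0} \<or> w \<notin> S k"
        using step[of w k] V0[of "x (Suc t) w"] by auto
      then show "indicator {w \<in> space G. h k w < 0} w * indicator (S k) w = (0::ennreal)"
        by auto
    qed
    moreover have "AE w in M. 0 = nn_cond_exp M G (\<lambda>_. 0) w"
      by (rule G.nn_cond_exp_F_meas) simp
    ultimately have "AE w in M. indicator {w \<in> space G. h k w < 0} w * nn_cond_exp M G (indicator (S k)) w = 0"
      by auto
    then show "AE w in M. h k w < 0 \<longrightarrow> P k (y t w) = 0"
      using condP AE_space
    proof eventually_elim
      case (elim w)
      then show ?case
        using P[OF k, of "y t w"] k by (auto simp: G_def indicator_def ennreal_eq_0_iff)
    qed
  qed simp

  have avg: "(\<Sum>k=1..K. h k w * P k (y t w)) \<le> V (x t w)" for w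
  proof -
    define Ey where "Ey = (\<Sum>k=1..K. (\<beta> k \<bullet> y t w) * P k (y t w))"
    define Ez where "Ez = (\<Sum>k=1..K. (\<beta> k \<bullet> \<beta> k) * P k (y t w))"
    have "(\<Sum>k=1..K. h k w * P k (y t w)) = V (x t w) * (\<Sum>k=1..K. P k (y t w)) + \<gamma> * Ez - Ey"
      unfolding Ey_def Ez_def h_def
      by (simp add: sum_distrib_left sum.distrib sum_subtractf algebra_simps)
    \<comment> \<open>Since \<open>Ez\<close> is nonnegative, \<gamma> \<le> \<delta> may be
      multiplied by it whatever the signs of the two constants.\<close>
    moreover have "0 \<le> Ez" unfolding Ez_def using P by (intro sum_nonneg) auto
    then have "\<gamma> * Ez \<le> \<delta> * Ez" using assms(3) by (rule mult_right_mono[rotated])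
    moreover have "\<delta> * Ez \<le> Ey"
      using assms(4)[of "y t w"] by (simp add: map_expectation_def Ey_def Ez_def)
    ultimately show ?thesis unfolding P1 by simp
  qed

  \<comment> \<open>The summand of the \<open>S k\<close> containing \<open>w\<close> already
    dominates V(x(t+1)); the remaining summands are nonnegative, as \<open>ennreal\<close> truncates
    at 0.\<close>
  have "AE w in M. ennreal (V (x (Suc t) w)) \<le> (\<Sum>k=1..K. ennreal (h k w) * indicator (S k) w)"
    using covered
  proof eventually_elim
    case (elim w)
    then obtain k where k: "k \<in> {1..K}" "w \<in> S k" by auto
    have "ennreal (V (x (Suc t) w)) \<le> ennreal (h k w) * indicator (S k) w"
      using step[OF k(2)] k(2) by (simp add: ennreal_leI)
    also have "\<dots> \<le> (\<Sum>k=1..K. ennreal (h k w) * indicator (S k) w)"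
      by (rule member_le_sum[OF k(1)]) auto
    finally show ?case .
  qed
  then have "AE w in M. nn_cond_exp M G (\<lambda>w. ennreal (V (x (Suc t) w))) w
      \<le> nn_cond_exp M G (\<lambda>w. \<Sum>k=1..K. ennreal (h k w) * indicator (S k) w) w"
    by (rule G.nn_cond_exp_mono) measurable
  moreover have "AE w in M. nn_cond_exp M G (\<lambda>w. \<Sum>k=1..K. ennreal (h k w) * indicator (S k) w) w
      = (\<Sum>k=1..K. nn_cond_exp M G (\<lambda>w. ennreal (h k w) * indicator (S k) w) w)"
    by (rule G.nn_cond_exp_sum_finite) auto
  moreover have "AE w in M. \<forall>k\<in>{1..K}. ennreal (h k w) * nn_cond_exp M G (indicator (S k)) w
      = nn_cond_exp M G (\<lambda>w. ennreal (h k w) * indicator (S k) w) w"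
    by (intro AE_finite_allI G.nn_cond_exp_prod) auto
  ultimately have "AE w in M. nn_cond_exp M G (\<lambda>w. ennreal (V (x (Suc t) w))) w \<le> ennreal (V (x t w))"
    using condP null
  proof eventually_elim
    case (elim w)
    \<comment> \<open>Where \<open>h k w\<close> is negative the weight vanishes by
      \<open>null\<close>, so each product is nonnegative. Otherwise the sum of truncated terms
      could exceed the real sum bounded in \<open>avg\<close>.\<close>
    have nonneg: "0 \<le> h k w * P k (y t w)"
      and prod: "ennreal (h k w) * ennreal (P k (y t w)) = ennreal (h k w * P k (y t w))"
      if "k \<in> {1..K}" for k
      using elim(5) P[OF that, of "y t w"] that
      by (cases "h k w < 0"; simp add: ennreal_mult)+
    have "(\<Sum>k=1..K. nn_cond_exp M G (\<lambda>w. ennreal (h k w) * indicator (S k) w) w)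
        = (\<Sum>k=1..K. ennreal (h k w * P k (y t w)))"
      using elim(3,4) prod by (intro sum.cong) auto
    also have "\<dots> = ennreal (\<Sum>k=1..K. h k w * P k (y t w))"
      using nonneg by (rule sum_ennreal)
    also have "\<dots> \<le> ennreal (V (x t w))"
      using avg by (rule ennreal_leI)
    finally show ?case using elim(1,2) by simp
  qed
  \<comment> \<open>Tower property: conditioning further on the coarser \<open>F\<close> preserves
    the bound and leaves the \<open>F\<close>-measurable V(x(t)) unchanged.\<close>
  then have "AE w in M. nn_cond_exp M F (nn_cond_exp M G (\<lambda>w. ennreal (V (x (Suc t) w)))) w
      \<le> nn_cond_exp M F (\<lambda>w. ennreal (V (x t w))) w"
    by (rule F.nn_cond_exp_mono) measurable
  moreover have "AE w in M. nn_cond_exp M F (\<lambda>w. ennreal (V (x (Suc t) w))) w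
      = nn_cond_exp M F (nn_cond_exp M G (\<lambda>w. ennreal (V (x (Suc t) w)))) w"
    by (rule F.nn_cond_exp_nested_subalg[OF subG FG]) measurable
  moreover have "AE w in M. ennreal (V (x t w)) = nn_cond_exp M F (\<lambda>w. ennreal (V (x t w))) w"
    using VF by (intro F.nn_cond_exp_F_meas) simp
  ultimately show "AE \<omega> in M.
    enn2ereal (nn_cond_exp M (generated_by M (x t)) (\<lambda>\<omega>. ennreal (V (x (Suc t) \<omega>))) \<omega>)
      - ereal (V (x t \<omega>)) \<le> 0"
    unfolding F_def[symmetric]
  proof eventually_elim
    case (elim w)
    then have "nn_cond_exp M F (\<lambda>w. ennreal (V (x (Suc t) w))) w \<le> ennreal (V (x t w))"
      by simp
    then have "enn2ereal (nn_cond_exp M F (\<lambda>w. ennreal (V (x (Suc t) w))) w) \<le> ereal (V (x t w))"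
      using V0 by (simp add: less_eq_ennreal.rep_eq enn2ereal_ennreal)
    \<comment> \<open>V(x(t)) is finite, so it can be moved across the inequality in the extended
      reals.\<close>
    then show ?case
      by (simp add: ereal_minus_le_iff)
  qed
qed

end
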